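(* Let $(X,d)$ be a compact metric space, let $f:X\to X$ be a continuous surjection, and let $\mathbb{F}=(f_n)_{n\in\mathbb{N}}$ be a sequence of feeble open continuous surjections $f_n:X\to X$ such that $f_n\circ f=f\circ f_n$ for every $n\in\mathbb{N}$ and $\sum_{n=1}^{\infty} D(f_n,f)<\infty$. If $\mathrm{Prox}_f(x)$ is dense in $X$ for each $x\in X$, then $(X,f)$ is Li-Yorke sensitive if and only if $(X,\mathbb{F})$ is Li-Yorke sensitive.
   Context: $D(g,h)=\sup_{x\in X}d(g(x),h(x))$ for continuous self maps $g,h$ of $X$. A map $g:X\to X$ is feeble open if $\mathrm{int}(g(U))\neq\emptyset$ for every non-empty open $U\subset X$. For $\mathbb{F}=(f_n)_{n\in\mathbb{N}}$ (with $\mathbb{N}=\{1,2,\dots\}$), put $\omega_n=f_n\circ f_{n-1}\circ\cdots\circ f_1$; $(X,\mathbb{F})$ denotes the non-autonomous system with orbits $\{\omega_n(x):n\in\mathbb{N}\}$. $\mathrm{Prox}_f(x)=\{y\in X:\liminf_{n\to\infty}d(f^n(x),f^n(y))=0\}$. $(X,\mathbb{F})$ is Li-Yorke sensitive if there is $\delta>0$ such that for each $x\in X$ and each neighborhood $U$ of $x$ there is $y\in U$ with $\limsup_{n\to\infty}d(\omega_n(x),\omega_n(y))>\delta$ and $\liminf_{n\to\infty}d(\omega_n(x),\omega_n(y))=0$. $(X,f)$ is Li-Yorke sensitive if the same holds with $\omega_n$ replaced by $f^n$. *)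

theory Defs
  imports "HOL-Analysis.Analysis"
begin

text \<open>The space \<open>X\<close> is the carrier type. As a real-valued supremum, \<open>sup_dist\<close> is meaningful only
  when the distances are bounded, as they are on a compact space.\<close>

definition sup_dist :: "('a::metric_space \<Rightarrow> 'a) \<Rightarrow> ('a \<Rightarrow> 'a) \<Rightarrow> real" where
  "sup_dist g h = (SUP x. dist (g x) (h x))"

definition feeble_open :: "('a::topological_space \<Rightarrow> 'a) \<Rightarrow> bool" where
  "feeble_open g \<longleftrightarrow> (\<forall>U. open U \<and> U \<noteq> {} \<longrightarrow> interior (g ` U) \<noteq> {})"

text \<open>The maps of a non-autonomous system are indexed from 1; the value at 0 is never used.\<close>

primrec omega :: "(nat \<Rightarrow> 'a \<Rightarrow> 'a) \<Rightarrow> nat \<Rightarrow> 'a \<Rightarrow> 'a" where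
  "omega F 0 = id"
| "omega F (Suc n) = F (Suc n) \<circ> omega F n"

definition Prox :: "('a::metric_space \<Rightarrow> 'a) \<Rightarrow> 'a \<Rightarrow> 'a set" where
  "Prox f x = {y. liminf (\<lambda>n. ereal (dist ((f ^^ n) x) ((f ^^ n) y))) = 0}"

text \<open>The argument is the sequence of maps giving the orbits: \<open>omega F\<close> for a non-autonomous system,
  \<open>\<lambda>n. f ^^ n\<close> for an autonomous one.\<close>

definition Li_Yorke_sensitive_orbits :: "(nat \<Rightarrow> 'a::metric_space \<Rightarrow> 'a) \<Rightarrow> bool" where
  "Li_Yorke_sensitive_orbits w \<longleftrightarrow>
    (\<exists>\<delta>::real. \<delta> > 0 \<and> (\<forall>x U. open U \<and> x \<in> U \<longrightarrow>
      (\<exists>y\<in>U. limsup (\<lambda>n. ereal (dist (w n x) (w n y))) > ereal \<delta> \<and>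
              liminf (\<lambda>n. ereal (dist (w n x) (w n y))) = 0)))"

definition Li_Yorke_sensitive :: "('a::metric_space \<Rightarrow> 'a) \<Rightarrow> bool" where
  "Li_Yorke_sensitive f \<longleftrightarrow> Li_Yorke_sensitive_orbits (\<lambda>n. f ^^ n)"

definition Li_Yorke_sensitive_nonaut :: "(nat \<Rightarrow> 'a::metric_space \<Rightarrow> 'a) \<Rightarrow> bool" where
  "Li_Yorke_sensitive_nonaut F \<longleftrightarrow> Li_Yorke_sensitive_orbits (omega F)"

end

theory Submission imports Defs begin

text \<open>
  Because \<open>f\<close> commutes with every \<open>f\<^sub>n\<close>, replacing the maps \<open>f\<^sub>i\<close> (\<open>m < i\<close>) one at a time by \<open>f\<close>
  moves a point of the orbit by at most \<open>D(f\<^sub>i, f)\<close> each, so \<open>f\<^sub>m\<^sub>+\<^sub>k \<circ> \<dots> \<circ> f\<^sub>m\<^sub>+\<^sub>1\<close> is uniformly close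
  to \<open>f\<^sup>k\<close>, with an error that is independent of \<open>k\<close> and tends to 0 with \<open>m\<close>. Since \<open>\<omega>\<^sub>m\<close> is
  surjective, continuous and feeble open, open sets can be moved back and forth along \<open>\<omega>\<^sub>m\<close>; hence
  \<open>f\<close> and \<open>\<F>\<close> are sensitive simultaneously, and density of the proximal cells passes from \<open>f\<close> to
  \<open>\<F>\<close>. Finally, when all proximal cells are dense (they are \<open>G\<^sub>\<delta>\<close> sets), sensitivity and Li-Yorke
  sensitivity are equivalent by the Baire category theorem.
\<close>

section \<open>Lower and upper limits expressed through arbitrarily late times\<close>

lemma liminf_ereal_eq_0_iff:
  fixes u :: "nat \<Rightarrow> real"
  assumes "\<And>n. u n \<ge> 0"
  shows "liminf (\<lambda>n. ereal (u n)) = 0 \<longleftrightarrow> (\<forall>e>0. \<forall>N. \<exists>n\<ge>N. u n < e)"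
proof
  assume L: "liminf (\<lambda>n. ereal (u n)) = 0"
  show "\<forall>e>0. \<forall>N. \<exists>n\<ge>N. u n < e"
  proof (intro allI impI, rule ccontr)
    fix e :: real and N assume e: "e > 0" and "\<not> (\<exists>n\<ge>N. u n < e)"
    then have "eventually (\<lambda>n. ereal e \<le> ereal (u n)) sequentially"
      unfolding eventually_sequentially by (auto simp: not_less)
    then have "ereal e \<le> liminf (\<lambda>n. ereal (u n))" by (rule Liminf_bounded)
    with L e show False by simp
  qed
next
  assume R: "\<forall>e>0. \<forall>N. \<exists>n\<ge>N. u n < e"
  show "liminf (\<lambda>n. ereal (u n)) = 0"
  proof (rule ccontr)
    assume "liminf (\<lambda>n. ereal (u n)) \<noteq> 0"
    moreover have "0 \<le> liminf (\<lambda>n. ereal (u n))"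
      by (rule Liminf_bounded) (simp add: assms)
    ultimately have "0 < liminf (\<lambda>n. ereal (u n))" by simp
    then obtain e where e: "0 < ereal e" "ereal e < liminf (\<lambda>n. ereal (u n))"
      using ereal_dense2 by blast
    then have "eventually (\<lambda>n. ereal e < ereal (u n)) sequentially"
      using less_LiminfD by blast
    then obtain N where "\<And>n. n \<ge> N \<Longrightarrow> e < u n"
      unfolding eventually_sequentially by auto
    with R e(1) show False by (metis ereal_less(2) order_less_asym)
  qed
qed

lemma limsup_ereal_gtD:
  fixes u :: "nat \<Rightarrow> real"
  assumes "limsup (\<lambda>n. ereal (u n)) > ereal c"
  shows "\<exists>n\<ge>N. u n > c"
proof (rule ccontr)
  assume "\<not> (\<exists>n\<ge>N. u n > c)"
  then have "eventually (\<lambda>n. ereal (u n) \<le> ereal c) sequentially"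
    unfolding eventually_sequentially by (auto simp: not_less)
  then have "limsup (\<lambda>n. ereal (u n)) \<le> ereal c" by (rule Limsup_bounded)
  with assms show False by simp
qed

text \<open>Strictness is lost here: values above \<open>c\<close> at late times may still tend to
  \<open>c\<close>.\<close>

lemma limsup_ereal_geI:
  fixes u :: "nat \<Rightarrow> real"
  assumes "\<And>N. \<exists>n\<ge>N. u n > c"
  shows "limsup (\<lambda>n. ereal (u n)) \<ge> ereal c"
proof (rule ccontr)
  assume "\<not> limsup (\<lambda>n. ereal (u n)) \<ge> ereal c"
  then have "eventually (\<lambda>n. ereal (u n) < ereal c) sequentially"
    by (intro Limsup_lessD) (simp add: not_le)
  then obtain N where "\<And>n. n \<ge> N \<Longrightarrow> u n < c"
    unfolding eventually_sequentially by auto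
  with assms[of N] show False by (metis order_less_asym)
qed

section \<open>Proximal cells, sensitivity and the Baire argument\<close>

lemma mem_Prox_iff:
  "y \<in> Prox f x \<longleftrightarrow> (\<forall>e>0. \<forall>N. \<exists>n\<ge>N. dist ((f ^^ n) x) ((f ^^ n) y) < e)"
  unfolding Prox_def mem_Collect_eq by (rule liminf_ereal_eq_0_iff) simp

text \<open>Demanding arbitrarily late separation times costs nothing for continuous maps on a compact space
  and makes the notion insensitive to initial segments of the orbit.\<close>

definition sensitive_orbits :: "(nat \<Rightarrow> 'a::metric_space \<Rightarrow> 'a) \<Rightarrow> bool" where
  "sensitive_orbits w \<longleftrightarrow> (\<exists>\<delta>>0. \<forall>U N. open U \<longrightarrow> U \<noteq> {} \<longrightarrow>
     (\<exists>u\<in>U. \<exists>v\<in>U. \<exists>n\<ge>N. dist (w n u) (w n v) > \<delta>))"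

text \<open>The same constant serves both notions: a limsup above \<delta> forces separation beyond
  \<delta> at arbitrarily late times.\<close>

lemma Li_Yorke_sensitive_imp_sensitive:
  assumes "Li_Yorke_sensitive_orbits w"
  shows "sensitive_orbits w"
proof -
  obtain \<delta> :: real where \<delta>: "\<delta> > 0" and LY: "\<forall>x U. open U \<and> x \<in> U \<longrightarrow>
      (\<exists>y\<in>U. limsup (\<lambda>n. ereal (dist (w n x) (w n y))) > ereal \<delta> \<and>
              liminf (\<lambda>n. ereal (dist (w n x) (w n y))) = 0)"
    using assms unfolding Li_Yorke_sensitive_orbits_def by (elim exE conjE)
  have "\<exists>u\<in>U. \<exists>v\<in>U. \<exists>n\<ge>N. dist (w n u) (w n v) > \<delta>" if U: "open U" "U \<noteq> {}" for U N
  proof -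
    obtain u where u: "u \<in> U" using U(2) by blast
    with LY U(1) obtain v
      where v: "v \<in> U" "limsup (\<lambda>n. ereal (dist (w n u) (w n v))) > ereal \<delta>" by meson
    have "\<exists>n\<ge>N. dist (w n u) (w n v) > \<delta>" by (rule limsup_ereal_gtD[OF v(2)])
    with u v(1) show ?thesis by (intro bexI)
  qed
  with \<delta> show ?thesis unfolding sensitive_orbits_def by (intro exI[of _ \<delta>] conjI allI impI)
qed

lemma closure_eq_UNIV_I:
  assumes "\<And>V. \<lbrakk>open V; V \<noteq> {}\<rbrakk> \<Longrightarrow> V \<inter> S \<noteq> {}"
  shows "closure S = UNIV"
  using assms[of "- closure S"] closure_subset[of S] by auto

text \<open>For fixed \<open>x\<close>, being separated from \<open>x\<close> at a late time and
  being close to \<open>x\<close> at a late time are open dense conditions on \<open>y\<close>. By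
  Baire, a point of \<open>U\<close> satisfies countably many of them at once. The premise
  \<open>prox\<close> is the form of density of proximal cells that this requires.\<close>

lemma sensitive_imp_Li_Yorke_sensitive:
  fixes w :: "nat \<Rightarrow> 'a::metric_space \<Rightarrow> 'a"
  assumes comp: "compact (UNIV :: 'a set)"
    and cont: "\<And>n. continuous_on UNIV (w n)"
    and prox: "\<And>x U e N. \<lbrakk>open U; U \<noteq> {}; e > 0\<rbrakk> \<Longrightarrow> \<exists>y\<in>U. \<exists>n\<ge>N. dist (w n x) (w n y) < e"
    and sens: "sensitive_orbits w"
  shows "Li_Yorke_sensitive_orbits w"
proof -
  obtain \<delta> where \<delta>: "\<delta> > 0"
    and sep: "\<And>U N. \<lbrakk>open U; U \<noteq> {}\<rbrakk> \<Longrightarrow> \<exists>u\<in>U. \<exists>v\<in>U. \<exists>n\<ge>N. dist (w n u) (w n v) > \<delta>"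
    using sens unfolding sensitive_orbits_def by blast
  \<comment> \<open>Replacing the pair \<open>u\<close>, \<open>v\<close> by a pair containing
    \<open>x\<close> halves \<delta>; the second halving restores the strict inequality, as the
    limsup is only known to be at least \<open>\<delta>/2\<close>.\<close>
  have "\<exists>y\<in>U. limsup (\<lambda>n. ereal (dist (w n x) (w n y))) > ereal (\<delta>/4) \<and>
              liminf (\<lambda>n. ereal (dist (w n x) (w n y))) = 0"
    if U: "open U" "x \<in> U" for x U
  proof -
    define G where "G N = {y. \<exists>n\<ge>N. \<delta>/2 < dist (w n x) (w n y)}" for N
    define P where "P N = {y. \<exists>n\<ge>N. dist (w n x) (w n y) < inverse (Suc N)}" for N
    have "open (G N)" for N
    proof -
      have "G N = (\<Union>n\<in>{N..}. {y. \<delta>/2 < dist (w n x) (w n y)})" by (auto simp: G_def)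
      then show ?thesis
        by (simp only:) (intro open_UN ballI open_Collect_less continuous_on_dist continuous_on_const cont)
    qed
    moreover have "open (P N)" for N
    proof -
      have "P N = (\<Union>n\<in>{N..}. {y. dist (w n x) (w n y) < inverse (Suc N)})" by (auto simp: P_def)
      then show ?thesis
        by (simp only:) (intro open_UN ballI open_Collect_less continuous_on_dist continuous_on_const cont)
    qed
    moreover have "closure (G N) = UNIV" for N
    proof -
      have "V \<inter> G N \<noteq> {}" if V: "open V" "V \<noteq> {}" for V
      proof -
        obtain u v n where uv: "u \<in> V" "v \<in> V" "n \<ge> N" "dist (w n u) (w n v) > \<delta>"
          using sep[OF V] by blast
        \<comment> \<open>At time \<open>n\<close> the orbit of \<open>x\<close> cannot be within
          \<open>\<delta>/2\<close> of both orbits, so \<open>u\<close> or \<open>v\<close> lies in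
          \<open>G N\<close>.\<close>
        have "dist (w n u) (w n v) \<le> dist (w n x) (w n u) + dist (w n x) (w n v)"
          by (metis dist_commute dist_triangle)
        with uv(4) have "\<delta>/2 < dist (w n x) (w n u) \<or> \<delta>/2 < dist (w n x) (w n v)"
          by linarith
        with uv show ?thesis by (auto simp: G_def)
      qed
      then show ?thesis by (rule closure_eq_UNIV_I)
    qed
    moreover have "closure (P N) = UNIV" for N
    proof -
      have "V \<inter> P N \<noteq> {}" if V: "open V" "V \<noteq> {}" for V
        using prox[OF V, of "inverse (Suc N)" N x] by (auto simp: P_def)
      then show ?thesis by (rule closure_eq_UNIV_I)
    qed
    \<comment> \<open>A compact metric space is locally compact and regular, so the Baire theorem
      applies to this countable family.\<close>
    ultimately have "euclidean closure_of \<Inter>(range G \<union> range P) = topspace euclidean"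
      using comp compact_imp_locally_compact_space[of "euclidean :: 'a topology"]
      by (intro Baire_category) (auto simp: compact_space_def regular_space_euclidean)
    then have "closure (\<Inter>(range G \<union> range P)) = UNIV" by simp
    then have "U \<inter> \<Inter>(range G \<union> range P) \<noteq> {}"
      using U open_Int_closure_eq_empty[OF U(1), of "\<Inter>(range G \<union> range P)"] by force
    then obtain y where "y \<in> U" "y \<in> \<Inter>(range G \<union> range P)" by (meson disjoint_iff)
    then have y: "y \<in> U" "y \<in> G N" "y \<in> P N" for N by simp_all
    have "limsup (\<lambda>n. ereal (dist (w n x) (w n y))) \<ge> ereal (\<delta>/2)"
      by (rule limsup_ereal_geI) (use y(2) in \<open>simp add: G_def\<close>)
    moreover have "ereal (\<delta>/4) < ereal (\<delta>/2)" using \<delta> by simp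
    ultimately have "limsup (\<lambda>n. ereal (dist (w n x) (w n y))) > ereal (\<delta>/4)"
      by (rule less_le_trans[rotated])
    moreover have "\<exists>n\<ge>N. dist (w n x) (w n y) < e" if "e > 0" for e N
    proof -
      obtain j where j: "inverse (real (Suc j)) < e"
        using reals_Archimedean[OF \<open>e > 0\<close>] by auto
      \<comment> \<open>The index of \<open>P\<close> controls both lateness and closeness, hence
        the maximum.\<close>
      have "y \<in> P (max j N)" by (rule y)
      then obtain n where n: "n \<ge> max j N" "dist (w n x) (w n y) < inverse (real (Suc (max j N)))"
        by (auto simp: P_def)
      have "inverse (real (Suc (max j N))) \<le> inverse (real (Suc j))"
        by (rule le_imp_inverse_le) auto
      with n j show ?thesis by (meson less_le_trans less_trans max.boundedE)
    qed
    then have "liminf (\<lambda>n. ereal (dist (w n x) (w n y))) = 0"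
      by (simp add: liminf_ereal_eq_0_iff)
    ultimately show ?thesis using y(1) by blast
  qed
  moreover have "\<delta>/4 > 0" using \<delta> by simp
  ultimately show ?thesis unfolding Li_Yorke_sensitive_orbits_def by blast
qed

section \<open>Properties inherited by iterates and compositions\<close>

lemma continuous_on_funpow:
  fixes f :: "'a::topological_space \<Rightarrow> 'a"
  assumes "continuous_on UNIV f"
  shows "continuous_on UNIV (f ^^ n)"
proof (induction n)
  case (Suc n)
  then show ?case using assms continuous_on_compose2[of UNIV f UNIV "f ^^ n"] by (simp add: o_def)
qed simp

lemma continuous_on_omega:
  fixes F :: "nat \<Rightarrow> 'a::topological_space \<Rightarrow> 'a"
  assumes "\<And>n. n \<ge> 1 \<Longrightarrow> continuous_on UNIV (F n)"
  shows "continuous_on UNIV (omega F n)"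
proof (induction n)
  case (Suc n)
  then show ?case
    using assms[of "Suc n"] continuous_on_compose2[of UNIV "F (Suc n)" UNIV "omega F n"]
    by (simp add: o_def)
qed (simp add: id_def)

lemma surj_omega:
  assumes "\<And>n. n \<ge> 1 \<Longrightarrow> surj (F n)"
  shows "surj (omega F n)"
proof (induction n)
  case (Suc n)
  then have "surj (F (Suc n) \<circ> omega F n)"
    by (intro comp_surj assms) auto
  then show ?case by (simp only: omega.simps)
qed simp

text \<open>The image under \<open>h\<close> contains a non-empty open set, to which feeble openness
  of \<open>g\<close> applies.\<close>

lemma feeble_open_compose:
  assumes "feeble_open g" "feeble_open h"
  shows "feeble_open (g \<circ> h)"
  unfolding feeble_open_def
proof (intro allI impI)
  fix U :: "'a set" assume "open U \<and> U \<noteq> {}"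
  then have "interior (h ` U) \<noteq> {}" using assms(2) by (simp add: feeble_open_def)
  then have "interior (g ` interior (h ` U)) \<noteq> {}" using assms(1) by (simp add: feeble_open_def)
  moreover have "interior (g ` interior (h ` U)) \<subseteq> interior ((g \<circ> h) ` U)"
    using interior_subset[of "h ` U"] by (intro interior_mono) auto
  ultimately show "interior ((g \<circ> h) ` U) \<noteq> {}" by blast
qed

lemma feeble_open_omega:
  assumes "\<And>n. n \<ge> 1 \<Longrightarrow> feeble_open (F n)"
  shows "feeble_open (omega F n)"
proof (induction n)
  case 0
  then show ?case by (simp add: feeble_open_def interior_open)
next
  case (Suc n)
  then have "feeble_open (F (Suc n) \<circ> omega F n)"
    by (intro feeble_open_compose assms) auto
  then show ?case by (simp only: omega.simps)
qed

section \<open>Uniform approximation of orbit tails by iterates of \<open>f\<close>\<close>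

text \<open>Compactness bounds all distances by the diameter, so the real supremum is a genuine
  upper bound.\<close>

lemma dist_le_sup_dist:
  fixes g h :: "'a::metric_space \<Rightarrow> 'a"
  assumes "compact (UNIV :: 'a set)"
  shows "dist (g x) (h x) \<le> sup_dist g h"
  unfolding sup_dist_def
proof (rule cSUP_upper)
  show "bdd_above (range (\<lambda>x. dist (g x) (h x)))"
    using diameter_bounded_bound[OF compact_imp_bounded[OF assms]]
    by (intro bdd_aboveI2[where M = "diameter (UNIV :: 'a set)"]) simp
qed simp

lemma comp_funpow_commute:
  assumes "g \<circ> f = f \<circ> g"
  shows "g ((f ^^ n) x) = (f ^^ n) (g x)"
  using assms by (induction n) (auto simp: fun_eq_iff)

text \<open>The additional \<open>f ^^ j\<close> is needed for the induction: it absorbs the factors already replaced by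
  \<open>f\<close>, and commuting it past \<open>F (Suc (m + k))\<close> avoids any Lipschitz condition on \<open>f\<close>.\<close>

lemma dist_omega_funpow_le:
  fixes f :: "'a::metric_space \<Rightarrow> 'a"
  assumes comp: "compact (UNIV :: 'a set)"
    and comm: "\<And>n. n \<ge> 1 \<Longrightarrow> F n \<circ> f = f \<circ> F n"
  shows "dist ((f ^^ j) (omega F (m + k) x)) ((f ^^ (j + k)) (omega F m x))
    \<le> (\<Sum>i\<in>{m..<m+k}. sup_dist (F (Suc i)) f)"
proof (induction k arbitrary: j)
  case (Suc k)
  let ?w = "omega F (m + k) x"
  have "dist ((f ^^ j) (F (Suc (m + k)) ?w)) ((f ^^ Suc j) ?w)
      = dist (F (Suc (m + k)) ((f ^^ j) ?w)) (f ((f ^^ j) ?w))"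
    using comp_funpow_commute[OF comm, of "Suc (m + k)" j ?w] by simp
  also have "\<dots> \<le> sup_dist (F (Suc (m + k))) f" by (rule dist_le_sup_dist[OF comp])
  finally show ?case
    using Suc.IH[of "Suc j"]
      dist_triangle[of "(f ^^ j) (F (Suc (m + k)) ?w)" "(f ^^ (j + Suc k)) (omega F m x)"
        "(f ^^ Suc j) ?w"]
    by (simp del: funpow.simps)
qed simp

text \<open>By the Cauchy criterion, blocks of the series beyond \<open>m\<close> are small whatever
  their length, so one \<open>m\<close> serves all \<open>k\<close> and \<open>x\<close>.\<close>

lemma dist_omega_funpow_less:
  fixes f :: "'a::metric_space \<Rightarrow> 'a"
  assumes comp: "compact (UNIV :: 'a set)"
    and comm: "\<And>n. n \<ge> 1 \<Longrightarrow> F n \<circ> f = f \<circ> F n"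
    and summ: "summable (\<lambda>n. sup_dist (F (Suc n)) f)"
    and "e > 0"
  obtains m where "m \<ge> N" "\<And>k x. dist (omega F (m + k) x) ((f ^^ k) (omega F m x)) < e"
proof -
  obtain M where M: "\<And>m n. m \<ge> M \<Longrightarrow> norm (\<Sum>i\<in>{m..<n}. sup_dist (F (Suc i)) f) < e"
    using summ \<open>e > 0\<close> unfolding summable_Cauchy by blast
  show thesis
  proof (rule that[of "max M N"])
    fix k x
    show "dist (omega F (max M N + k) x) ((f ^^ k) (omega F (max M N) x)) < e"
      using dist_omega_funpow_le[where F = F and f = f and j = 0 and m = "max M N" and k = k
          and x = x, OF comp comm]
        M[of "max M N" "max M N + k"] by simp
  qed simp
qed

lemma dist_perturb:
  assumes "dist a a' < e" "dist b b' < e"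
  shows "dist a' b' < dist a b + 2 * e"
  using assms dist_triangle[of a' b' a] dist_triangle[of a b' b] by (simp add: dist_commute)

section \<open>Transfer of proximality and sensitivity along \<open>omega F m\<close>\<close>

theorem corollary10:
  fixes f :: "'a::metric_space \<Rightarrow> 'a" and F :: "nat \<Rightarrow> 'a \<Rightarrow> 'a"
  assumes "compact (UNIV :: 'a set)"
    and "continuous_on UNIV f" and "surj f"
    and "\<And>n. n \<ge> 1 \<Longrightarrow> continuous_on UNIV (F n)"
    and "\<And>n. n \<ge> 1 \<Longrightarrow> surj (F n)"
    and "\<And>n. n \<ge> 1 \<Longrightarrow> feeble_open (F n)"
    and "\<And>n. n \<ge> 1 \<Longrightarrow> F n \<circ> f = f \<circ> F n"
    and "summable (\<lambda>n. sup_dist (F (Suc n)) f)"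
    and "\<And>x. closure (Prox f x) = UNIV"
  shows "Li_Yorke_sensitive f \<longleftrightarrow> Li_Yorke_sensitive_nonaut F"
proof -
  let ?W = "omega F"
  note approx = dist_omega_funpow_less[where F = F and f = f, OF assms(1,7,8)]
  have prox_f: "\<exists>y\<in>U. \<exists>n\<ge>N. dist ((f ^^ n) x) ((f ^^ n) y) < e"
    if U: "open U" "U \<noteq> {}" and "e > 0" for x U e N
  proof -
    obtain y where "y \<in> U" "y \<in> Prox f x"
      using U assms(9)[of x] open_Int_closure_eq_empty[of U "Prox f x"] by blast
    then show ?thesis using \<open>e > 0\<close> unfolding mem_Prox_iff by blast
  qed
  \<comment> \<open>Images of open sets need not be open; their interiors take their place when
    moving forward along \<open>?W m\<close>.\<close>
  have image: "open (interior (?W m ` U))" "interior (?W m ` U) \<noteq> {}"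
    "interior (?W m ` U) \<subseteq> ?W m ` U" if "open U" "U \<noteq> {}" for U m
    using feeble_open_omega[where F = F and n = m, OF assms(6)] that interior_subset
    by (auto simp: feeble_open_def)
  have prox_F: "\<exists>y\<in>U. \<exists>n\<ge>N. dist (?W n x) (?W n y) < e"
    if U: "open U" "U \<noteq> {}" and e: "e > 0" for x U e N
  proof -
    obtain m where m: "m \<ge> N" "\<And>k x. dist (?W (m + k) x) ((f ^^ k) (?W m x)) < e/4"
      using approx[of "e/4"] e by (metis divide_pos_pos zero_less_numeral)
    \<comment> \<open>The time bound 0 suffices, since \<open>m \<ge> N\<close> already makes
      \<open>m + k\<close> late. The errors add up to \<open>e/2 + 2 * (e/4) = e\<close>.\<close>
    obtain y k where y: "y \<in> U" "dist ((f ^^ k) (?W m x)) ((f ^^ k) (?W m y)) < e/2"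
      using prox_f[OF image(1)[OF U, of m] image(2)[OF U, of m], of "e/2" 0 "?W m x"]
        image(3)[OF U, of m] e by auto
    have "dist (?W (m + k) x) (?W (m + k) y) < e"
      using dist_perturb[of "(f ^^ k) (?W m x)" "?W (m + k) x" "e/4" "(f ^^ k) (?W m y)"
          "?W (m + k) y"] m(2) y(2) by (simp add: dist_commute)
    then show ?thesis using y(1) m(1) by (meson le_add1 order_trans)
  qed
  have "sensitive_orbits ?W" if sens: "sensitive_orbits (\<lambda>n. f ^^ n)"
  proof -
    obtain \<delta> where \<delta>: "\<delta> > 0" and sep: "\<And>U N. \<lbrakk>open U; U \<noteq> {}\<rbrakk> \<Longrightarrow>
        \<exists>u\<in>U. \<exists>v\<in>U. \<exists>n\<ge>N. dist ((f ^^ n) u) ((f ^^ n) v) > \<delta>"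
      using sens unfolding sensitive_orbits_def by blast
    have "\<exists>u\<in>U. \<exists>v\<in>U. \<exists>n\<ge>N. dist (?W n u) (?W n v) > \<delta>/2"
      if U: "open U" "U \<noteq> {}" for U N
    proof -
      obtain m where m: "m \<ge> N" "\<And>k x. dist (?W (m + k) x) ((f ^^ k) (?W m x)) < \<delta>/4"
        using approx[of "\<delta>/4"] \<delta> by (metis divide_pos_pos zero_less_numeral)
      obtain u v k where uv: "u \<in> U" "v \<in> U" "dist ((f ^^ k) (?W m u)) ((f ^^ k) (?W m v)) > \<delta>"
        using sep[OF image(1,2)[OF U], of m 0] image(3)[OF U, of m] by blast
      \<comment> \<open>Approximating both orbits costs \<open>2 * (\<delta>/4)\<close>, leaving
        \<open>\<delta>/2\<close>.\<close>
      have "dist (?W (m + k) u) (?W (m + k) v) > \<delta>/2"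
        using dist_perturb[OF m(2)[of k u] m(2)[of k v]] uv(3) by simp
      then show ?thesis using uv(1,2) m(1) by (meson le_add1 order_trans)
    qed
    then show ?thesis
      using \<delta> unfolding sensitive_orbits_def by (intro exI[of _ "\<delta>/2"]) auto
  qed
  moreover have "sensitive_orbits (\<lambda>n. f ^^ n)" if sens: "sensitive_orbits ?W"
  proof -
    obtain \<delta> where \<delta>: "\<delta> > 0" and sep: "\<And>U N. \<lbrakk>open U; U \<noteq> {}\<rbrakk> \<Longrightarrow>
        \<exists>u\<in>U. \<exists>v\<in>U. \<exists>n\<ge>N. dist (?W n u) (?W n v) > \<delta>"
      using sens unfolding sensitive_orbits_def by blast
    have "\<exists>u\<in>U. \<exists>v\<in>U. \<exists>n\<ge>N. dist ((f ^^ n) u) ((f ^^ n) v) > \<delta>/2"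
      if U: "open U" "U \<noteq> {}" for U N
    proof -
      obtain m where m: "\<And>k x. dist (?W (m + k) x) ((f ^^ k) (?W m x)) < \<delta>/4"
        using approx[of "\<delta>/4"] \<delta> by (metis divide_pos_pos zero_less_numeral)
      \<comment> \<open>In this direction \<open>U\<close> is pulled back: continuity makes the
        preimage open and surjectivity makes it non-empty.\<close>
      have "open (?W m -` U)"
        using continuous_on_omega[where F = F and n = m, OF assms(4)] U(1)
        by (simp add: open_vimage)
      moreover have "?W m -` U \<noteq> {}"
        using surj_omega[where F = F and n = m, OF assms(5)] U(2)
        by (metis image_vimage_eq inf_top.right_neutral image_empty)
      \<comment> \<open>Late separation is essential: \<open>n \<ge> m + N\<close> allows the first
        \<open>m\<close> maps to be split off with at least \<open>N\<close> steps
        remaining.\<close>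
      ultimately obtain u v n where uv: "?W m u \<in> U" "?W m v \<in> U" "n \<ge> m + N"
          "dist (?W n u) (?W n v) > \<delta>"
        using sep[of "?W m -` U" "m + N"] by auto
      define k where "k = n - m"
      have n: "n = m + k" "k \<ge> N" using uv(3) by (auto simp: k_def)
      have "dist ((f ^^ k) (?W m u)) ((f ^^ k) (?W m v)) > \<delta>/2"
        using dist_perturb[of "(f ^^ k) (?W m u)" "?W n u" "\<delta>/4" "(f ^^ k) (?W m v)" "?W n v"]
          m[of k] uv(4) by (simp add: dist_commute n)
      then show ?thesis using uv(1,2) n(2) by blast
    qed
    then show ?thesis
      using \<delta> unfolding sensitive_orbits_def by (intro exI[of _ "\<delta>/2"]) auto
  qed
  moreover have "Li_Yorke_sensitive_orbits (\<lambda>n. f ^^ n) \<longleftrightarrow> sensitive_orbits (\<lambda>n. f ^^ n)"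
    using sensitive_imp_Li_Yorke_sensitive[OF assms(1) continuous_on_funpow[OF assms(2)] prox_f]
      Li_Yorke_sensitive_imp_sensitive by blast
  moreover have "Li_Yorke_sensitive_orbits ?W \<longleftrightarrow> sensitive_orbits ?W"
    using sensitive_imp_Li_Yorke_sensitive[OF assms(1)
        continuous_on_omega[where F = F, OF assms(4)] prox_F] Li_Yorke_sensitive_imp_sensitive by blast
  ultimately show ?thesis
    unfolding Li_Yorke_sensitive_def Li_Yorke_sensitive_nonaut_def by blast
qed

end
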